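(* Let $G$ be a finite group such that the common divisor simplicial complex $\mathcal{G}(G)$ is connected. Let $b$ be any vertex of $\mathcal{G}(G)$ and let $p$ be any prime dividing $b$. Then the induced map $\eta_*\colon \pi_1(\mathcal{G}(G),b)\to\pi_1(\mathcal{D}(G),p)$ is a group isomorphism.
   Context: For a finite group $G$, $\mathrm{Irr}(G)$ is the set of irreducible complex characters of $G$ and $\mathrm{cd}(G)=\{\chi(1) : \chi\in\mathrm{Irr}(G)\}$ is the set of character degrees. An (abstract) simplicial complex is a pair $(\mathcal{V},\mathcal{S})$ with $\mathcal{V}$ a finite set of vertices and $\mathcal{S}$ a set of nonempty subsets of $\mathcal{V}$ (the simplices), containing all singletons and closed under taking nonempty subsets. Put $X=\mathrm{cd}(G)$ and $X^*=X\setminus\{1\}$. The common divisor simplicial complex $\mathcal{G}(G)=\mathcal{G}(X)$ has vertex set $X^*$, and a nonempty $V\subseteq X^*$ is a simplex iff $\gcd(V)>1$. The prime divisor simplicial complex $\mathcal{D}(G)=\mathcal{D}(X)$ has as vertices the primes dividing at least one element of $X^*$, and a nonempty set $Q$ of such primes is a simplex iff some $v\in X$ is divisible by every element of $Q$. For a simplex $\sigma$ of $\mathcal{G}(X)$, $\eta(\sigma)$ is the simplex of $\mathcal{D}(X)$ whose vertices are the primes dividing $\gcd(\sigma)$. Edge-paths. In a simplicial complex, an edge-path $\langle v_1,v_2\rangle\langle v_2,v_3\rangle\cdots\langle v_{n-1},v_n\rangle$ ($n\ge 2$) is a sequence of vertices $v_1,\dots,v_n$ such that each $\{v_i,v_{i+1}\}$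 is a simplex ($v_i=v_{i+1}$ is allowed); it is an edge-loop based at $v_1$ if $v_1=v_n$. A simple equivalence replaces a segment $\langle v,w\rangle$ of an edge-path by $\langle v,u\rangle\langle u,w\rangle$, or vice versa, where $u,v,w$ are not necessarily distinct vertices contained in a common simplex. Two edge-paths are homotopic if one is obtained from the other by finitely many simple equivalences. $\pi_1(\mathcal{K},b)$ is the group of homotopy classes of edge-loops based at the vertex $b$, under concatenation (this is isomorphic to the topological fundamental group). The induced map. Let $b$ be a vertex of $\mathcal{G}(X)$ and $p$ a prime dividing $b$. For an edge-loop $\mathcal{L}=\langle v_1,v_2\rangle\cdots\langle v_{n-1},v_n\rangle$ in $\mathcal{G}(X)$ with $v_1=v_n=b$, choose for each $1\le i\le n-1$ a vertex $\omega_i$ of $\eta(\{v_i,v_{i+1}\})$, i.e. a prime dividing both $v_i$ and $v_{i+1}$. Then $\eta_*([\mathcal{L}])$ is the class in $\pi_1(\mathcal{D}(X),p)$ of the edge-loop $\langle p,\omega_1\rangle\langle\omega_1,\omega_2\rangle\cdots\langle\omega_{n-2},\omega_{n-1}\rangle\langle\omega_{n-1},p\rangle$; this class does not depend on the choices made. *)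

theory Defs
  imports
    "HOL-Computational_Algebra.Primes"
    "HOL-Algebra.Group"
    "Jordan_Normal_Form.VS_Connect"
begin

section \<open>Complex characters and character degrees of a group\<close>

text \<open>\<open>units_of (ring_mat TYPE(complex) n ())\<close> is the general linear group of
  degree \<open>n\<close> over the complex numbers.\<close>

definition complex_rep :: "('a, 'm) monoid_scheme \<Rightarrow> nat \<Rightarrow> ('a \<Rightarrow> complex mat) \<Rightarrow> bool" where
  "complex_rep G n \<rho> \<longleftrightarrow> \<rho> \<in> hom G (units_of (ring_mat TYPE(complex) n ()))"

definition irreducible_rep :: "('a, 'm) monoid_scheme \<Rightarrow> nat \<Rightarrow> ('a \<Rightarrow> complex mat) \<Rightarrow> bool" where
  "irreducible_rep G n \<rho> \<longleftrightarrow> complex_rep G n \<rho> \<and> n > 0 \<and>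
     (\<forall>W. subspace class_ring W (module_vec TYPE(complex) n) \<longrightarrow>
          (\<forall>g\<in>carrier G. \<forall>w\<in>W. \<rho> g *\<^sub>v w \<in> W) \<longrightarrow>
          W = {0\<^sub>v n} \<or> W = carrier_vec n)"

definition mat_trace :: "complex mat \<Rightarrow> complex" where
  "mat_trace A = (\<Sum>i<dim_row A. A $$ (i, i))"

definition character_of :: "('a, 'm) monoid_scheme \<Rightarrow> ('a \<Rightarrow> complex mat) \<Rightarrow> 'a \<Rightarrow> complex" where
  "character_of G \<rho> = (\<lambda>g\<in>carrier G. mat_trace (\<rho> g))"

definition Irr :: "('a, 'm) monoid_scheme \<Rightarrow> ('a \<Rightarrow> complex) set" where
  "Irr G = {character_of G \<rho> | n \<rho>. irreducible_rep G n \<rho>}"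

definition char_degrees :: "('a, 'm) monoid_scheme \<Rightarrow> nat set" where
  "char_degrees G = {d. \<exists>\<chi>\<in>Irr G. \<chi> \<one>\<^bsub>G\<^esub> = of_nat d}"


section \<open>Simplicial complexes\<close>

type_synonym 'v scomplex = "'v set \<times> 'v set set"

abbreviation vertices :: "'v scomplex \<Rightarrow> 'v set" where "vertices K \<equiv> fst K"
abbreviation simplices :: "'v scomplex \<Rightarrow> 'v set set" where "simplices K \<equiv> snd K"

definition simplicial_complex :: "'v scomplex \<Rightarrow> bool" where
  "simplicial_complex K \<longleftrightarrow> finite (vertices K) \<and>
     (\<forall>\<sigma>\<in>simplices K. \<sigma> \<noteq> {} \<and> \<sigma> \<subseteq> vertices K) \<and>
     (\<forall>v\<in>vertices K. {v} \<in> simplices K) \<and>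
     (\<forall>\<sigma>\<in>simplices K. \<forall>\<tau>. \<tau> \<noteq> {} \<longrightarrow> \<tau> \<subseteq> \<sigma> \<longrightarrow> \<tau> \<in> simplices K)"

definition common_divisor_complex :: "nat set \<Rightarrow> nat scomplex" where
  "common_divisor_complex X =
     (X - {1}, {V. V \<noteq> {} \<and> V \<subseteq> X - {1} \<and> Gcd V > 1})"

definition prime_divisors_of :: "nat set \<Rightarrow> nat set" where
  "prime_divisors_of X = {q. prime q \<and> (\<exists>v\<in>X - {1}. q dvd v)}"

definition prime_divisor_complex :: "nat set \<Rightarrow> nat scomplex" where
  "prime_divisor_complex X =
     (prime_divisors_of X,
      {Q. Q \<noteq> {} \<and> Q \<subseteq> prime_divisors_of X \<and> (\<exists>v\<in>X. \<forall>q\<in>Q. q dvd v)})"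

definition eta :: "nat set \<Rightarrow> nat set" where
  "eta \<sigma> = {q. prime q \<and> q dvd Gcd \<sigma>}"


section \<open>The edge-path group\<close>

text \<open>The edge-path with vertex sequence \<open>v\<^sub>1, \<dots>, v\<^sub>n\<close> is represented by the
  list of these \<open>n \<ge> 2\<close> vertices; concatenation of \<open>vs\<close> and \<open>ws\<close> is then \<open>vs @ tl ws\<close>.\<close>

definition edge_path :: "'v scomplex \<Rightarrow> 'v list \<Rightarrow> bool" where
  "edge_path K vs \<longleftrightarrow> length vs \<ge> 2 \<and> set vs \<subseteq> vertices K \<and>
     successively (\<lambda>v w. {v, w} \<in> simplices K) vs"

definition connected_complex :: "'v scomplex \<Rightarrow> bool" where
  "connected_complex K \<longleftrightarrow>
     (\<forall>v\<in>vertices K. \<forall>w\<in>vertices K. \<exists>vs. edge_path K vs \<and> hd vs = v \<and> last vs = w)"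

inductive simple_equiv :: "'v scomplex \<Rightarrow> 'v list \<Rightarrow> 'v list \<Rightarrow> bool" for K where
  "\<lbrakk>edge_path K (xs @ [v, w] @ ys); \<sigma> \<in> simplices K; {u, v, w} \<subseteq> \<sigma>\<rbrakk>
   \<Longrightarrow> simple_equiv K (xs @ [v, w] @ ys) (xs @ [v, u, w] @ ys)"

definition homotopic_paths :: "'v scomplex \<Rightarrow> 'v list \<Rightarrow> 'v list \<Rightarrow> bool" where
  "homotopic_paths K = equivclp (simple_equiv K)"

definition edge_loops :: "'v scomplex \<Rightarrow> 'v \<Rightarrow> 'v list set" where
  "edge_loops K b = {vs. edge_path K vs \<and> hd vs = b \<and> last vs = b}"

definition loop_homotopy :: "'v scomplex \<Rightarrow> 'v \<Rightarrow> ('v list \<times> 'v list) set" where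
  "loop_homotopy K b =
     {(vs, ws). vs \<in> edge_loops K b \<and> ws \<in> edge_loops K b \<and> homotopic_paths K vs ws}"

definition loop_class :: "'v scomplex \<Rightarrow> 'v \<Rightarrow> 'v list \<Rightarrow> 'v list set" where
  "loop_class K b vs = loop_homotopy K b `` {vs}"

text \<open>As usual for quotients, the operations on classes below are written as a union over all
  representatives; it is a union of equal classes.\<close>

definition pi1 :: "'v scomplex \<Rightarrow> 'v \<Rightarrow> 'v list set monoid" where
  "pi1 K b =
     \<lparr>carrier = edge_loops K b // loop_homotopy K b,
      mult = (\<lambda>A B. \<Union>vs\<in>A. \<Union>ws\<in>B. loop_class K b (vs @ tl ws)),
      one = loop_class K b [b, b]\<rparr>"


section \<open>The induced map\<close>

text \<open>The admissible choices \<open>\<omega>\<^sub>1, \<dots>, \<omega>\<^sub>n\<^sub>-\<^sub>1\<close> for the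
  edge-loop \<open>v\<^sub>1, \<dots>, v\<^sub>n\<close>.\<close>

definition eta_choices :: "nat list \<Rightarrow> nat list set" where
  "eta_choices vs = {\<omega>s. length \<omega>s = length vs - 1 \<and>
     (\<forall>i < length vs - 1. \<omega>s ! i \<in> eta {vs ! i, vs ! Suc i})}"

definition eta_star :: "nat set \<Rightarrow> nat \<Rightarrow> nat list set \<Rightarrow> nat list set" where
  "eta_star X p A =
     (\<Union>vs\<in>A. \<Union>\<omega>s\<in>eta_choices vs. loop_class (prime_divisor_complex X) p (p # \<omega>s @ [p]))"


section \<open>Basic facts\<close>

lemma mat_trace_one: "mat_trace (1\<^sub>m n) = of_nat n"
  by (simp add: mat_trace_def)

lemma complex_rep_one:
  assumes "group G" "complex_rep G n \<rho>"
  shows "\<rho> \<one>\<^bsub>G\<^esub> = 1\<^sub>m n"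
proof -
  have "monoid (ring_mat TYPE(complex) n ())"
    by (rule ring.is_monoid[OF ring_mat])
  then have "group (units_of (ring_mat TYPE(complex) n ()))"
    by (rule monoid.units_group)
  then have "\<rho> \<one>\<^bsub>G\<^esub> = \<one>\<^bsub>units_of (ring_mat TYPE(complex) n ())\<^esub>"
    using hom_one[of \<rho> G] assms unfolding complex_rep_def by blast
  then show ?thesis by (simp add: units_of_def ring_mat_simps)
qed

lemma char_degrees_iff:
  assumes "group G"
  shows "d \<in> char_degrees G \<longleftrightarrow> (\<exists>\<rho>. irreducible_rep G d \<rho>)"
proof -
  have one: "\<one>\<^bsub>G\<^esub> \<in> carrier G"
    using assms by (simp add: group.is_monoid monoid.one_closed)
  have "character_of G \<rho> \<one>\<^bsub>G\<^esub> = of_nat n" if "irreducible_rep G n \<rho>" for n \<rho>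
    using that complex_rep_one[OF assms, of n \<rho>] one
    by (simp add: irreducible_rep_def character_of_def mat_trace_one)
  then show ?thesis
    unfolding char_degrees_def Irr_def by (auto 4 4 dest: of_nat_eq_iff[THEN iffD1])
qed

lemma zero_notin_char_degrees: "group G \<Longrightarrow> 0 \<notin> char_degrees G"
  by (simp add: char_degrees_iff irreducible_rep_def)

lemma complex_rep_carrier:
  assumes "complex_rep G n \<rho>" "g \<in> carrier G"
  shows "\<rho> g \<in> carrier_mat n n"
  using assms unfolding complex_rep_def
  by (auto dest!: hom_in_carrier simp: units_of_def Units_def ring_mat_simps)

lemma complex_rep_mult:
  assumes "complex_rep G n \<rho>" "g \<in> carrier G" "h \<in> carrier G"
  shows "\<rho> (g \<otimes>\<^bsub>G\<^esub> h) = \<rho> g * \<rho> h"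
  using assms hom_mult[of \<rho> G "units_of (ring_mat TYPE(complex) n ())" g h]
  by (simp add: complex_rep_def units_of_def ring_mat_simps)

lemma mult_mat_vec_span:
  assumes A: "A \<in> carrier_mat n n" and S: "S \<subseteq> carrier_vec n"
    and AS: "\<And>s. s \<in> S \<Longrightarrow> A *\<^sub>v s \<in> S"
    and w: "w \<in> LinearCombinations.module.span class_ring (module_vec TYPE(complex) n) S"
  shows "A *\<^sub>v w \<in> LinearCombinations.module.span class_ring (module_vec TYPE(complex) n) S"
proof -
  interpret vec_space "TYPE(complex)" n .
  let ?N = "{w \<in> carrier_vec n. A *\<^sub>v w \<in> span S}"
  have sub: "submodule class_ring (span S) V"
    using span_is_submodule S by simp
  have "A *\<^sub>v 0\<^sub>v n = 0\<^sub>v n" using A by auto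
  then have A0: "A *\<^sub>v 0\<^sub>v n \<in> span S"
    using submodule.zero_closed[OF sub] by simp
  have "submodule class_ring ?N V"
  proof (rule submodule.intro)
    show "module class_ring V" by (rule vec_module)
  qed (use A A0 submodule.m_closed[OF sub] submodule.zero_closed[OF sub]
        submodule.smult_closed[OF sub] in
      \<open>auto simp: module_vec_simps class_ring_simps mult_add_distrib_mat_vec mult_mat_vec\<close>)
  moreover have "S \<subseteq> ?N" using S AS in_own_span S by auto
  ultimately have "span S \<subseteq> ?N" by (rule span_is_subset[rotated])
  then show ?thesis using w by auto
qed

lemma irreducible_rep_degree_le:
  assumes G: "group G" "finite (carrier G)" and irr: "irreducible_rep G n \<rho>"
  shows "n \<le> card (carrier G)"
proof -
  interpret vec_space "TYPE(complex)" n .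
  have rep: "complex_rep G n \<rho>" and n: "n > 0" using irr by (auto simp: irreducible_rep_def)
  define v :: "complex vec" where "v = unit_vec n 0"
  define S where "S = (\<lambda>g. \<rho> g *\<^sub>v v) ` carrier G"
  have v: "v \<in> carrier_vec n" by (simp add: v_def)
  have S: "S \<subseteq> carrier_vec n"
    unfolding S_def using mult_mat_vec_carrier[OF complex_rep_carrier[OF rep] v] by auto
  have "\<one>\<^bsub>G\<^esub> \<in> carrier G"
    using G by (simp add: group.is_monoid monoid.one_closed)
  then have vS: "v \<in> S"
    unfolding S_def using complex_rep_one[OF G(1) rep] v by (auto intro!: image_eqI[of _ _ "\<one>\<^bsub>G\<^esub>"])
  have inv: "\<rho> g *\<^sub>v s \<in> S" if g: "g \<in> carrier G" and s: "s \<in> S" for g s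
  proof -
    from s obtain h where h: "h \<in> carrier G" "s = \<rho> h *\<^sub>v v" unfolding S_def by auto
    have "\<rho> g *\<^sub>v s = \<rho> (g \<otimes>\<^bsub>G\<^esub> h) *\<^sub>v v"
      using complex_rep_mult[OF rep g h(1)] complex_rep_carrier[OF rep g]
        complex_rep_carrier[OF rep h(1)] v h(2) by (simp add: assoc_mult_mat_vec)
    moreover have "g \<otimes>\<^bsub>G\<^esub> h \<in> carrier G"
      using G g h(1) by (simp add: group.is_monoid monoid.m_closed)
    ultimately show ?thesis unfolding S_def by auto
  qed
  have "subspace class_ring (span S) V" using span_is_subspace S by simp
  moreover have "\<forall>g\<in>carrier G. \<forall>w\<in>span S. \<rho> g *\<^sub>v w \<in> span S"
    using mult_mat_vec_span[OF complex_rep_carrier[OF rep] S inv] by blast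
  ultimately have "span S = {0\<^sub>v n} \<or> span S = carrier_vec n"
    using irr unfolding irreducible_rep_def by blast
  moreover have "v \<in> span S" using in_own_span S vS by auto
  moreover have "v \<noteq> 0\<^sub>v n"
    unfolding v_def using n by (metis index_unit_vec(1) index_zero_vec(1) zero_neq_one)
  ultimately have "span S = carrier_vec n" by auto
  then have "dim \<le> card S"
    using gen_ge_dim[of S] S G(2) by (simp add: S_def)
  also have "card S \<le> card (carrier G)" unfolding S_def by (rule card_image_le[OF G(2)])
  finally show ?thesis by (simp add: dim_is_n)
qed

lemma finite_char_degrees: "group G \<Longrightarrow> finite (carrier G) \<Longrightarrow> finite (char_degrees G)"
  by (rule finite_subset[of _ "{..card (carrier G)}"])
    (auto simp: char_degrees_iff dest: irreducible_rep_degree_le)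

lemma simplicial_complex_common_divisor:
  assumes "finite X" "0 \<notin> X"
  shows "simplicial_complex (common_divisor_complex X)"
proof -
  have *: "Gcd \<tau> > 1" if "\<tau> \<subseteq> \<sigma>" "\<tau> \<noteq> {}" "Gcd \<sigma> > 1" "\<sigma> \<subseteq> X" for \<sigma> \<tau> :: "nat set"
  proof -
    have "Gcd \<sigma> dvd Gcd \<tau>" using that(1) by (meson Gcd_dvd Gcd_greatest subsetD)
    moreover have "Gcd \<tau> \<noteq> 0" using that assms by (auto simp: Gcd_0_iff)
    ultimately show ?thesis using that(3) dvd_imp_le[of "Gcd \<sigma>" "Gcd \<tau>"] by linarith
  qed
  have "1 < x" if "x \<in> X" "x \<noteq> 1" for x
    using that assms(2) by (metis less_one nat_neq_iff)
  then have "\<forall>v\<in>vertices (common_divisor_complex X). {v} \<in> simplices (common_divisor_complex X)"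
    by (simp add: common_divisor_complex_def)
  moreover have "\<forall>\<sigma>\<in>simplices (common_divisor_complex X). \<forall>\<tau>. \<tau> \<noteq> {} \<longrightarrow> \<tau> \<subseteq> \<sigma> \<longrightarrow>
      \<tau> \<in> simplices (common_divisor_complex X)"
    using * unfolding common_divisor_complex_def by simp blast
  moreover have "finite (vertices (common_divisor_complex X))"
    "\<forall>\<sigma>\<in>simplices (common_divisor_complex X). \<sigma> \<noteq> {} \<and> \<sigma> \<subseteq> vertices (common_divisor_complex X)"
    using assms(1) by (simp_all add: common_divisor_complex_def)
  ultimately show ?thesis
    unfolding simplicial_complex_def by blast
qed

lemma simplicial_complex_prime_divisor:
  assumes "finite X" "0 \<notin> X"
  shows "simplicial_complex (prime_divisor_complex X)"
proof -
  have "prime_divisors_of X \<subseteq> (\<Union>v\<in>X. {q. q dvd v})"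
    by (auto simp: prime_divisors_of_def)
  moreover have "finite {q. q dvd v}" if "v \<in> X" for v
    using that assms by (metis finite_divisors_nat gr0I)
  ultimately have "finite (prime_divisors_of X)"
    using assms(1) by (meson finite_UN_I finite_subset)
  then show ?thesis
    unfolding simplicial_complex_def prime_divisor_complex_def
    by (auto simp: prime_divisors_of_def)
qed

lemma eta_simplex:
  assumes "0 \<notin> X" "\<sigma> \<in> simplices (common_divisor_complex X)"
  shows "eta \<sigma> \<in> simplices (prime_divisor_complex X)"
proof -
  from assms obtain v where v: "v \<in> \<sigma>" "\<sigma> \<subseteq> X - {1}" "Gcd \<sigma> > 1"
    unfolding common_divisor_complex_def by auto
  then have "eta \<sigma> \<noteq> {}"
    using prime_factor_nat[of "Gcd \<sigma>"] by (auto simp: eta_def)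
  moreover have "q dvd v" if "q \<in> eta \<sigma>" for q
    using that v(1) by (auto simp: eta_def intro: dvd_trans[OF _ Gcd_dvd])
  ultimately show ?thesis
    using v by (auto simp: prime_divisor_complex_def prime_divisors_of_def eta_def)
qed

lemma simple_equiv_edge_path:
  assumes K: "simplicial_complex K" and "simple_equiv K vs ws"
  shows "edge_path K vs" "edge_path K ws" "hd vs = hd ws" "last vs = last ws"
proof -
  from assms(2) obtain xs v w ys \<sigma> u where *: "edge_path K (xs @ [v, w] @ ys)"
    "\<sigma> \<in> simplices K" "{u, v, w} \<subseteq> \<sigma>"
    and eq: "vs = xs @ [v, w] @ ys" "ws = xs @ [v, u, w] @ ys"
    by (auto elim!: simple_equiv.cases)
  from * have "{v, u} \<subseteq> \<sigma>" "{u, w} \<subseteq> \<sigma>" by auto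
  with K *(2) have "{v, u} \<in> simplices K" "{u, w} \<in> simplices K"
    unfolding simplicial_complex_def by (meson insert_not_empty)+
  moreover have "u \<in> vertices K" using K *(2,3) unfolding simplicial_complex_def by blast
  ultimately show "edge_path K ws"
    using * by (auto simp: eq edge_path_def successively_append_iff)
  show "edge_path K vs" using * by (simp add: eq)
  show "hd vs = hd ws" by (cases xs) (simp_all add: eq)
  show "last vs = last ws" by (simp add: eq)
qed

lemma edge_path_append:
  assumes "edge_path K vs" "edge_path K ws" "last vs = hd ws"
  shows "edge_path K (vs @ tl ws)"
proof -
  from assms(2) obtain a c zs where ws: "ws = a # c # zs"
    unfolding edge_path_def by (cases ws; cases "tl ws") auto
  show ?thesis
    using assms unfolding edge_path_def ws
    by (auto simp: successively_append_iff successively_Cons)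
qed

lemma append_tl_eq: "vs \<noteq> [] \<Longrightarrow> ws \<noteq> [] \<Longrightarrow> last vs = hd ws \<Longrightarrow> vs @ tl ws = butlast vs @ ws"
  by (metis append_butlast_last_id append.assoc append_Cons append_Nil list.collapse)

lemma edge_path_not_Nil: "edge_path K vs \<Longrightarrow> vs \<noteq> []"
  by (auto simp: edge_path_def)

lemma edge_loops_not_Nil: "vs \<in> edge_loops K b \<Longrightarrow> vs \<noteq> []"
  by (auto simp: edge_loops_def edge_path_def)

lemma edge_loops_append:
  assumes vs: "vs \<in> edge_loops K b" and ws: "ws \<in> edge_loops K b"
  shows "vs @ tl ws \<in> edge_loops K b"
proof -
  have "edge_path K (vs @ tl ws)"
    using assms by (intro edge_path_append) (simp_all add: edge_loops_def)
  moreover have "hd (vs @ tl ws) = b"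
    using vs edge_loops_not_Nil[OF vs] by (simp add: edge_loops_def)
  moreover have "last (vs @ tl ws) = b"
    using append_tl_eq[of vs ws] assms edge_loops_not_Nil[OF vs] edge_loops_not_Nil[OF ws]
    by (simp add: edge_loops_def)
  ultimately show ?thesis by (simp add: edge_loops_def)
qed

lemma simple_equiv_append:
  assumes "simple_equiv K vs vs'" "edge_path K ws" "last vs = hd ws"
  shows "simple_equiv K (vs @ tl ws) (vs' @ tl ws)"
  using assms
proof (induction rule: simple_equiv.induct)
  case (1 xs v w ys \<sigma> u)
  then show ?case
    using simple_equiv.intros[of K xs v w "ys @ tl ws" \<sigma> u]
      edge_path_append[of K "xs @ [v, w] @ ys" ws] by simp
qed

lemma simple_equiv_append2:
  assumes "simple_equiv K ws ws'" "edge_path K vs" "last vs = hd ws"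
  shows "simple_equiv K (butlast vs @ ws) (butlast vs @ ws')"
  using assms
proof (induction rule: simple_equiv.induct)
  case (1 xs v w ys \<sigma> u)
  have "edge_path K (butlast vs @ xs @ [v, w] @ ys)"
    using edge_path_append[OF 1(4) 1(1) 1(5)] append_tl_eq[of vs "xs @ [v, w] @ ys"]
      edge_path_not_Nil[OF 1(4)] 1(5) by simp
  then show ?case
    using simple_equiv.intros[of K "butlast vs @ xs" v w ys \<sigma> u] 1(2,3) by simp
qed

lemma homotopic_edge_loops:
  assumes "simplicial_complex K" "homotopic_paths K vs ws" "vs \<in> edge_loops K b"
  shows "ws \<in> edge_loops K b"
  using assms(2) unfolding homotopic_paths_def
proof (induction rule: equivclp_induct)
  case base
  show ?case by (rule assms(3))
next
  case (step y z)
  from step(2) have "edge_path K z \<and> hd z = hd y \<and> last z = last y"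
    using simple_equiv_edge_path[OF assms(1)] by metis
  with step(3) show ?case by (simp add: edge_loops_def)
qed

lemma homotopic_append:
  assumes K: "simplicial_complex K"
    and "homotopic_paths K vs vs'" "vs \<in> edge_loops K b"
    and "homotopic_paths K ws ws'" "ws \<in> edge_loops K b"
  shows "homotopic_paths K (vs @ tl ws) (vs' @ tl ws')"
proof -
  have "homotopic_paths K (vs @ tl ws) (vs' @ tl ws)"
    using assms(2) unfolding homotopic_paths_def
  proof (induction rule: equivclp_induct)
    case base
    show ?case by simp
  next
    case (step y z)
    have "y \<in> edge_loops K b"
      using homotopic_edge_loops[OF K _ assms(3)] step(1) by (simp add: homotopic_paths_def)
    moreover have "z \<in> edge_loops K b"
      using homotopic_edge_loops[OF K _ assms(3)] step(1,2) equivclp_into_equivclp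
      unfolding homotopic_paths_def by metis
    ultimately have "simple_equiv K (y @ tl ws) (z @ tl ws) \<or> simple_equiv K (z @ tl ws) (y @ tl ws)"
      using step(2) assms(5) simple_equiv_append[of K y z ws] simple_equiv_append[of K z y ws]
      by (auto simp: edge_loops_def)
    then show ?case using step(3) by (meson equivclp_into_equivclp)
  qed
  moreover have vs': "vs' \<in> edge_loops K b" using homotopic_edge_loops[OF K assms(2,3)] .
  have "homotopic_paths K (vs' @ tl ws) (vs' @ tl ws')"
    using assms(4) unfolding homotopic_paths_def
  proof (induction rule: equivclp_induct)
    case base
    show ?case by simp
  next
    case (step y z)
    have yz: "y \<in> edge_loops K b" "z \<in> edge_loops K b"
      using homotopic_edge_loops[OF K _ assms(5)] step(1,2) equivclp_into_equivclp
      unfolding homotopic_paths_def by metis+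
    then have "vs' @ tl y = butlast vs' @ y" "vs' @ tl z = butlast vs' @ z"
      using append_tl_eq[of vs' y] append_tl_eq[of vs' z] vs' edge_loops_not_Nil[OF vs']
        edge_loops_not_Nil[OF yz(1)] edge_loops_not_Nil[OF yz(2)]
      by (simp_all add: edge_loops_def)
    then have "simple_equiv K (vs' @ tl y) (vs' @ tl z) \<or> simple_equiv K (vs' @ tl z) (vs' @ tl y)"
      using step(2) vs' yz simple_equiv_append2[of K y z vs'] simple_equiv_append2[of K z y vs']
      by (auto simp: edge_loops_def)
    then show ?case using step(3) by (meson equivclp_into_equivclp)
  qed
  ultimately show ?thesis
    unfolding homotopic_paths_def by (meson equivclp_trans)
qed

lemma equiv_loop_homotopy: "equiv (edge_loops K b) (loop_homotopy K b)"
proof (rule equivI)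
  show "refl_on (edge_loops K b) (loop_homotopy K b)"
    by (auto simp: refl_on_def loop_homotopy_def homotopic_paths_def)
  show "sym (loop_homotopy K b)"
    by (auto simp: sym_def loop_homotopy_def homotopic_paths_def dest: equivclp_sym)
  show "trans (loop_homotopy K b)"
    unfolding trans_def loop_homotopy_def homotopic_paths_def by (auto dest: equivclp_trans)
qed (auto simp: loop_homotopy_def)

lemma loop_class_eq_iff:
  assumes "vs \<in> edge_loops K b" "ws \<in> edge_loops K b"
  shows "loop_class K b vs = loop_class K b ws \<longleftrightarrow> homotopic_paths K vs ws"
  using eq_equiv_class_iff[OF equiv_loop_homotopy assms] assms
  by (simp add: loop_class_def loop_homotopy_def)

lemma carrier_pi1: "carrier (pi1 K b) = loop_class K b ` edge_loops K b"
  by (auto simp: pi1_def loop_class_def quotient_def)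

lemma mult_pi1:
  assumes K: "simplicial_complex K" and vs: "vs \<in> edge_loops K b" and ws: "ws \<in> edge_loops K b"
  shows "loop_class K b vs \<otimes>\<^bsub>pi1 K b\<^esub> loop_class K b ws = loop_class K b (vs @ tl ws)"
proof -
  have "loop_class K b (vs' @ tl ws') = loop_class K b (vs @ tl ws)"
    if "vs' \<in> loop_class K b vs" "ws' \<in> loop_class K b ws" for vs' ws'
  proof -
    from that have *: "vs' \<in> edge_loops K b" "ws' \<in> edge_loops K b"
      "homotopic_paths K vs vs'" "homotopic_paths K ws ws'"
      by (auto simp: loop_class_def loop_homotopy_def)
    then have "loop_class K b (vs @ tl ws) = loop_class K b (vs' @ tl ws')"
      using homotopic_append[OF K *(3) vs *(4) ws] vs ws
      by (simp add: loop_class_eq_iff edge_loops_append)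
    then show ?thesis by simp
  qed
  moreover have "vs \<in> loop_class K b vs" "ws \<in> loop_class K b ws"
    using vs ws by (auto simp: loop_class_def loop_homotopy_def homotopic_paths_def)
  ultimately have "(\<Union>vs'\<in>loop_class K b vs. \<Union>ws'\<in>loop_class K b ws.
      loop_class K b (vs' @ tl ws')) = loop_class K b (vs @ tl ws)"
    by blast
  then show ?thesis by (simp add: pi1_def)
qed

lemma edge_path_rev: "edge_path K vs \<Longrightarrow> edge_path K (rev vs)"
  unfolding edge_path_def by (simp add: insert_commute)

lemma edge_path_append_rev:
  assumes K: "simplicial_complex K" and "edge_path K vs"
  shows "homotopic_paths K (vs @ tl (rev vs)) [hd vs, hd vs]"
  using assms(2)
proof (induction vs rule: rev_induct)
  case Nil
  then show ?case by (simp add: edge_path_def)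
next
  case (snoc w xs)
  then obtain zs u where xs: "xs = zs @ [u]"
    by (cases xs rule: rev_cases) (auto simp: edge_path_def)
  have uw: "{u, w} \<in> simplices K" and u: "u \<in> vertices K" and zs: "set zs \<subseteq> vertices K"
    and succ: "successively (\<lambda>v w. {v, w} \<in> simplices K) (zs @ [u])"
    using snoc.prems unfolding edge_path_def xs by (auto simp: successively_append_iff)
  have uu: "{u, u} \<in> simplices K" using K u by (auto simp: simplicial_complex_def)
  have "successively (\<lambda>v w. {v, w} \<in> simplices K) (rev (zs @ [u]))"
    using succ by (subst successively_rev) (simp add: insert_commute)
  then have "edge_path K (zs @ [u, u] @ rev zs)"
    using succ u zs uu
    by (auto simp: edge_path_def successively_append_iff successively_Cons)
  then have 1: "simple_equiv K (zs @ [u, u] @ rev zs) (zs @ [u, w, u] @ rev zs)"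
    using uw by (intro simple_equiv.intros[of _ _ _ _ _ "{u, w}"]) auto
  have "homotopic_paths K (zs @ [u, u] @ rev zs) [hd (xs @ [w]), hd (xs @ [w])]"
  proof (cases zs rule: rev_cases)
    case Nil
    then show ?thesis by (simp add: xs homotopic_paths_def)
  next
    case ts: (snoc ts t)
    have path: "edge_path K xs"
      using succ u zs ts by (auto simp: edge_path_def xs)
    have "edge_path K (xs @ tl (rev xs))"
      by (rule edge_path_append[OF path edge_path_rev[OF path]]) (simp add: xs)
    then have "simple_equiv K (ts @ [t, u] @ [t] @ rev ts) (ts @ [t, u, u] @ [t] @ rev ts)"
      using succ by (intro simple_equiv.intros[of _ _ _ _ _ "{t, u}"])
        (auto simp: xs ts successively_append_iff)
    then have "homotopic_paths K (zs @ [u, u] @ rev zs) (xs @ tl (rev xs))"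
      unfolding homotopic_paths_def
      by (intro equivclp_sym[OF r_into_equivclp]) (simp add: xs ts)
    moreover have "homotopic_paths K (xs @ tl (rev xs)) [hd xs, hd xs]"
      by (rule snoc.IH[OF path])
    moreover have "hd (xs @ [w]) = hd xs" by (cases zs) (simp_all add: xs)
    ultimately show ?thesis
      unfolding homotopic_paths_def by (metis equivclp_trans)
  qed
  then show ?case
    using r_into_equivclp[of "simple_equiv K", OF 1] unfolding homotopic_paths_def xs
    by simp (meson equivclp_sym equivclp_trans)
qed

lemma group_pi1:
  assumes K: "simplicial_complex K" and b: "b \<in> vertices K"
  shows "group (pi1 K b)"
proof (rule groupI)
  have one: "\<one>\<^bsub>pi1 K b\<^esub> = loop_class K b [b, b]" by (simp add: pi1_def)
  have bb: "[b, b] \<in> edge_loops K b"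
    using assms by (auto simp: edge_loops_def edge_path_def simplicial_complex_def)
  show "\<one>\<^bsub>pi1 K b\<^esub> \<in> carrier (pi1 K b)" using bb by (simp add: one carrier_pi1)
  show "x \<otimes>\<^bsub>pi1 K b\<^esub> y \<in> carrier (pi1 K b)"
    if "x \<in> carrier (pi1 K b)" "y \<in> carrier (pi1 K b)" for x y
    using that by (auto simp: carrier_pi1 mult_pi1[OF K] edge_loops_append)
  show "x \<otimes>\<^bsub>pi1 K b\<^esub> y \<otimes>\<^bsub>pi1 K b\<^esub> z = x \<otimes>\<^bsub>pi1 K b\<^esub> (y \<otimes>\<^bsub>pi1 K b\<^esub> z)"
    if "x \<in> carrier (pi1 K b)" "y \<in> carrier (pi1 K b)" "z \<in> carrier (pi1 K b)" for x y z
  proof -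
    from that obtain us vs ws where "us \<in> edge_loops K b" "vs \<in> edge_loops K b"
      "ws \<in> edge_loops K b" "x = loop_class K b us" "y = loop_class K b vs" "z = loop_class K b ws"
      by (auto simp: carrier_pi1)
    moreover from this(2) have "us @ tl (vs @ tl ws) = (us @ tl vs) @ tl ws"
      by (simp add: edge_loops_not_Nil[of vs K b])
    ultimately show ?thesis by (simp add: mult_pi1[OF K] edge_loops_append)
  qed
  show "\<one>\<^bsub>pi1 K b\<^esub> \<otimes>\<^bsub>pi1 K b\<^esub> x = x" if x: "x \<in> carrier (pi1 K b)" for x
  proof -
    from x obtain vs where vs: "vs \<in> edge_loops K b" "x = loop_class K b vs"
      by (auto simp: carrier_pi1)
    then obtain w ys where bw: "vs = [b, w] @ ys"
      by (cases vs; cases "tl vs") (auto simp: edge_loops_def edge_path_def)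
    have "simple_equiv K ([] @ [b, w] @ ys) ([] @ [b, b, w] @ ys)"
      using vs(1) by (intro simple_equiv.intros[of _ _ _ _ _ "{b, w}"])
        (auto simp: bw edge_loops_def edge_path_def)
    then have "homotopic_paths K ([b, b] @ tl vs) vs"
      unfolding homotopic_paths_def by (intro equivclp_sym[OF r_into_equivclp]) (simp add: bw)
    then show ?thesis
      using loop_class_eq_iff[of "[b, b] @ tl vs" K b vs] vs edge_loops_append[OF bb vs(1)]
        mult_pi1[OF K bb vs(1)] by (simp add: one)
  qed
  show "\<exists>y\<in>carrier (pi1 K b). y \<otimes>\<^bsub>pi1 K b\<^esub> x = \<one>\<^bsub>pi1 K b\<^esub>"
    if x: "x \<in> carrier (pi1 K b)" for x
  proof -
    from x obtain vs where vs: "vs \<in> edge_loops K b" "x = loop_class K b vs"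
      by (auto simp: carrier_pi1)
    then have rev: "rev vs \<in> edge_loops K b"
      by (auto simp: edge_loops_def edge_path_rev hd_rev last_rev)
    have "homotopic_paths K (rev vs @ tl vs) [b, b]"
      using edge_path_append_rev[OF K, of "rev vs"] rev by (auto simp: edge_loops_def)
    then have "loop_class K b (rev vs) \<otimes>\<^bsub>pi1 K b\<^esub> x = \<one>\<^bsub>pi1 K b\<^esub>"
      using mult_pi1[OF K rev vs(1)] vs(2) edge_loops_append[OF rev vs(1)] bb
        loop_class_eq_iff[of "rev vs @ tl vs" K b "[b, b]"] by (simp add: one)
    then show ?thesis using rev by (auto simp: carrier_pi1)
  qed
qed

end

theory Submission
  imports Defs
begin

text \<open>
  The theorem is an instance of Dowker duality. A relation \<open>R\<close> between finite sets \<open>A\<close> and \<open>B\<close>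
  defines a complex \<open>K\<close> on \<open>A\<close>, whose simplices are the nonempty sets related to a common element
  of \<open>B\<close>, and a complex \<open>L\<close> on \<open>B\<close>, defined in the same way by the converse relation. For
  \<open>A = X - {1}\<close>, for \<open>B\<close> the set of primes dividing an element of \<open>A\<close>, and for \<open>R v q\<close> meaning
  \<open>q dvd v\<close>, these are the common divisor and the prime divisor complex of \<open>X\<close>: a greatest common
  divisor exceeds 1 iff some prime divides all members of the set.

  Each edge \<open>{v, w}\<close> of \<open>K\<close> has a witness, an element of \<open>B\<close> related to both \<open>v\<close> and \<open>w\<close>. The
  induced map sends a loop \<open>vs\<close> at \<open>b\<close> to \<open>p # cs @ [p]\<close> for any list \<open>cs\<close> of witnesses of its
  consecutive edges. Two facts make it an isomorphism.

  \<^item> The homotopy class of \<open>p # cs @ [p]\<close> depends only on that of \<open>vs\<close>. All witnesses chosen at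
    edges that meet in a vertex \<open>v\<close> span a simplex of \<open>L\<close>, since \<open>v\<close> itself is a common element
    for them. So one choice can be exchanged for another edge by edge (\<open>homotopic_witnesses\<close>), and
    a simple equivalence of \<open>vs\<close> inside a simplex of \<open>K\<close> merely repeats one witness
    (\<open>homotopic_witnesses_simple_equiv\<close>).

  \<^item> The construction is its own inverse: if \<open>cs\<close> witnesses \<open>vs\<close>, then \<open>vs\<close>, read as a list of
    elements related to consecutive vertices, witnesses \<open>p # cs @ [p]\<close> for the converse relation
    (\<open>edge_witnesses_dual\<close>). Going to \<open>L\<close> and back thus turns \<open>vs\<close> into \<open>b # vs @ [b]\<close>, which is
    homotopic to \<open>vs\<close>.

  By symmetry the first fact holds from \<open>L\<close> to \<open>K\<close> as well, so the second gives injectivity and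
  surjectivity (\<open>dowker_iso\<close>).
\<close>

section \<open>Homotopies of edge-paths\<close>

lemma homotopic_paths_sym: "homotopic_paths K vs ws \<Longrightarrow> homotopic_paths K ws vs"
  unfolding homotopic_paths_def by (rule equivclp_sym)

lemma homotopic_paths_trans [trans]:
  "homotopic_paths K us vs \<Longrightarrow> homotopic_paths K vs ws \<Longrightarrow> homotopic_paths K us ws"
  unfolding homotopic_paths_def by (rule equivclp_trans)

lemma homotopic_paths_refl: "homotopic_paths K vs vs"
  by (simp add: homotopic_paths_def)

lemma homotopic_insert:
  assumes "edge_path K (xs @ v # w # ys)" "\<sigma> \<in> simplices K" "{u, v, w} \<subseteq> \<sigma>"
  shows "homotopic_paths K (xs @ v # w # ys) (xs @ v # u # w # ys)"
  using simple_equiv.intros[of K xs v w ys \<sigma> u] assms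
  unfolding homotopic_paths_def by (simp add: r_into_equivclp)

lemma homotopic_Cons:
  assumes K: "simplicial_complex K" and x: "x \<in> vertices K" "{x, hd vs} \<in> simplices K"
    and "homotopic_paths K vs ws"
  shows "homotopic_paths K (x # vs) (x # ws)"
  using assms(4) unfolding homotopic_paths_def
proof (induction rule: equivclp_induct)
  case base
  show ?case by simp
next
  case (step y z)
  have "homotopic_paths K vs y" using step(1) by (simp add: homotopic_paths_def)
  then have "hd y = hd vs"
    unfolding homotopic_paths_def
    by (induction rule: equivclp_induct) (use simple_equiv_edge_path(3)[OF K] in metis)+
  moreover have "hd z = hd y" using step(2) simple_equiv_edge_path(3)[OF K] by metis
  moreover have "hd vs \<in> vertices K"
    using K x(2) unfolding simplicial_complex_def by blast
  then have "edge_path K [x, hd vs]"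
    using x by (simp add: edge_path_def)
  ultimately have "simple_equiv K (x # y) (x # z) \<or> simple_equiv K (x # z) (x # y)"
    using step(2) simple_equiv_append2[of K y z "[x, hd vs]"]
      simple_equiv_append2[of K z y "[x, hd vs]"] by auto
  then show ?case using step(3) by (meson equivclp_into_equivclp)
qed

section \<open>The two complexes of a relation\<close>

definition dowker_complex :: "'a set \<Rightarrow> 'b set \<Rightarrow> ('a \<Rightarrow> 'b \<Rightarrow> bool) \<Rightarrow> 'a scomplex" where
  "dowker_complex A B R = (A, {\<sigma>. \<sigma> \<noteq> {} \<and> \<sigma> \<subseteq> A \<and> (\<exists>y\<in>B. \<forall>x\<in>\<sigma>. R x y)})"

text \<open>
  A path with \<open>n\<close> vertices has \<open>n - 1\<close> witnesses. The trivial path \<open>[v]\<close>, which is not an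
  \<^const>\<open>edge_path\<close>, is included so that inductions along the path can start there.
\<close>

inductive edge_witnesses :: "'b set \<Rightarrow> ('a \<Rightarrow> 'b \<Rightarrow> bool) \<Rightarrow> 'a list \<Rightarrow> 'b list \<Rightarrow> bool"
  for B R where
  single: "edge_witnesses B R [v] []"
| Cons: "\<lbrakk>c \<in> B; R v c; R w c; edge_witnesses B R (w # vs) cs\<rbrakk>
    \<Longrightarrow> edge_witnesses B R (v # w # vs) (c # cs)"

lemma edge_witnesses_singleton_iff: "edge_witnesses B R [v] cs \<longleftrightarrow> cs = []"
  by (auto elim: edge_witnesses.cases intro: edge_witnesses.single)

lemma edge_witnesses_Cons_iff:
  "edge_witnesses B R (v # w # vs) cs \<longleftrightarrow>
    (\<exists>c ds. cs = c # ds \<and> c \<in> B \<and> R v c \<and> R w c \<and> edge_witnesses B R (w # vs) ds)"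
  by (auto elim: edge_witnesses.cases intro: edge_witnesses.Cons)

lemma edge_witnesses_subset: "edge_witnesses B R vs cs \<Longrightarrow> set cs \<subseteq> B"
  by (induction rule: edge_witnesses.induct) auto

lemma edge_witnesses_append:
  assumes "edge_witnesses B R (xs @ [v]) cs" "edge_witnesses B R (v # ys) ds"
  shows "edge_witnesses B R (xs @ v # ys) (cs @ ds)"
  using assms
proof (induction "xs @ [v]" cs arbitrary: xs rule: edge_witnesses.induct)
  case (single u)
  then show ?case by simp
next
  case (Cons c u w vs cs xs)
  then obtain zs where zs: "xs = u # zs" "w # vs = zs @ [v]" by (cases xs) auto
  then have "edge_witnesses B R (zs @ v # ys) (cs @ ds)" using Cons by blast
  moreover from zs(2) obtain us where "zs @ v # ys = w # us" by (cases zs) auto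
  ultimately show ?case using Cons zs(1) by (simp add: edge_witnesses.Cons)
qed

lemma edge_witnesses_related_hd:
  assumes "edge_witnesses B R vs cs" "R (last vs) q"
  shows "R (hd vs) (hd (cs @ [q]))"
  using assms by (cases rule: edge_witnesses.cases) auto

lemma edge_witnesses_related_last:
  assumes "edge_witnesses B R vs cs" "R (hd vs) p"
  shows "R (last vs) (last (p # cs))"
  using assms by (induction arbitrary: p rule: edge_witnesses.induct) auto

text \<open>
  Every inner vertex \<open>v\<close> of the path is related to the witnesses of the two edges at \<open>v\<close>, hence is
  a witness, for the converse relation, of the edge between them; the end points serve the two new
  edges to \<open>p\<close> and \<open>q\<close>. This is the symmetry behind the duality.
\<close>

lemma edge_witnesses_dual:
  assumes "edge_witnesses B R vs cs" "set vs \<subseteq> A" "R (hd vs) p" "R (last vs) q"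
  shows "edge_witnesses A (\<lambda>y x. R x y) (p # cs @ [q]) vs"
  using assms
  by (induction arbitrary: p rule: edge_witnesses.induct) (auto intro!: edge_witnesses.intros)

locale dowker_relation =
  fixes A :: "'a set" and B :: "'b set" and R :: "'a \<Rightarrow> 'b \<Rightarrow> bool"
  assumes finite_left: "finite A" and finite_right: "finite B"
    and related_left: "x \<in> A \<Longrightarrow> \<exists>y\<in>B. R x y"
    and related_right: "y \<in> B \<Longrightarrow> \<exists>x\<in>A. R x y"
begin

abbreviation "K \<equiv> dowker_complex A B R"
abbreviation "L \<equiv> dowker_complex B A (\<lambda>y x. R x y)"

lemma dual: "dowker_relation B A (\<lambda>y x. R x y)"
  using finite_left finite_right related_left related_right by unfold_locales auto

lemma simplicial_complex_left: "simplicial_complex K"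
  unfolding simplicial_complex_def dowker_complex_def
  using finite_left related_left by auto (meson subsetD)

lemma simplicial_complex_right: "simplicial_complex L"
  by (rule dowker_relation.simplicial_complex_left[OF dual])

lemma vertices_left: "vertices K = A"
  by (simp add: dowker_complex_def)

lemma vertices_right: "vertices L = B"
  by (simp add: dowker_complex_def)

lemma simplex_left_iff:
  "\<sigma> \<in> simplices K \<longleftrightarrow> \<sigma> \<noteq> {} \<and> \<sigma> \<subseteq> A \<and> (\<exists>y\<in>B. \<forall>x\<in>\<sigma>. R x y)"
  by (simp add: dowker_complex_def)

lemma simplex_right_iff:
  "\<sigma> \<in> simplices L \<longleftrightarrow> \<sigma> \<noteq> {} \<and> \<sigma> \<subseteq> B \<and> (\<exists>x\<in>A. \<forall>y\<in>\<sigma>. R x y)"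
  by (simp add: dowker_complex_def)

lemma edge_path_if_witnesses:
  assumes "edge_witnesses B R vs cs" "set vs \<subseteq> A" "length vs \<ge> 2"
  shows "edge_path K vs"
proof -
  have "successively (\<lambda>v w. {v, w} \<in> simplices K) vs"
    using assms(1,2) by (induction rule: edge_witnesses.induct) (auto simp: simplex_left_iff)
  then show ?thesis using assms by (simp add: edge_path_def vertices_left)
qed

lemma ex_edge_witnesses:
  assumes "vs \<noteq> []" "successively (\<lambda>v w. {v, w} \<in> simplices K) vs"
  shows "\<exists>cs. edge_witnesses B R vs cs"
  using assms
proof (induction vs rule: induct_list012)
  case (3 v w vs)
  then obtain cs where "edge_witnesses B R (w # vs) cs" by auto
  moreover obtain c where "c \<in> B" "R v c" "R w c"
    using 3 by (auto simp: simplex_left_iff)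
  ultimately show ?case by (meson edge_witnesses.Cons)
qed (auto intro: edge_witnesses.single)

lemma edge_path_of_witnesses:
  assumes "edge_witnesses B R vs cs" "set vs \<subseteq> A"
    and "p \<in> B" "q \<in> B" "R (hd vs) p" "R (last vs) q"
  shows "edge_path L (p # cs @ [q])"
  using dowker_relation.edge_path_if_witnesses[OF dual
      edge_witnesses_dual[OF assms(1,2,5,6)]]
    assms(3,4) edge_witnesses_subset[OF assms(1)] by simp

text \<open>
  The witnesses are replaced one after the other, starting at \<open>p\<close>. In \<open>p, c, r\<close>, with \<open>r\<close> the
  vertex after \<open>c\<close>, the new witness \<open>d\<close> is first inserted between \<open>p\<close> and \<open>c\<close>: these three are
  related to the first vertex of the path. Then \<open>c\<close> is removed from \<open>d, c, r\<close>: these are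
  related to its second vertex. What remains is the same claim for the rest of the path, with \<open>d\<close>
  as new starting point; this is why \<open>p\<close> must be arbitrary.
\<close>

lemma homotopic_witnesses:
  assumes "edge_witnesses B R vs cs" "edge_witnesses B R vs ds" "set vs \<subseteq> A"
    and "p \<in> B" "q \<in> B" "R (hd vs) p" "R (last vs) q"
  shows "homotopic_paths L (p # cs @ [q]) (p # ds @ [q])"
  using assms
proof (induction arbitrary: p ds rule: edge_witnesses.induct)
  case (single v)
  then show ?case by (simp add: edge_witnesses_singleton_iff homotopic_paths_refl)
next
  case (Cons c v w vs cs p ds)
  then obtain d es where ds: "ds = d # es" and d: "d \<in> B" "R v d" "R w d"
    and es: "edge_witnesses B R (w # vs) es"
    by (auto simp: edge_witnesses_Cons_iff)
  have v: "v \<in> A" and w: "w \<in> A" and p: "p \<in> B" "R v p" and q: "q \<in> B" "R (last (w # vs)) q"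
    using Cons.prems by auto
  obtain r rs where r: "cs @ [q] = r # rs" by (cases "cs @ [q]") auto
  have "r \<in> B" using r edge_witnesses_subset[OF Cons.hyps(4)] q(1) by (cases cs) auto
  moreover have "R w r"
    using edge_witnesses_related_hd[OF Cons.hyps(4) q(2)] r by simp
  ultimately have dcr: "{c, d, r} \<in> simplices L"
    using Cons.hyps d w by (auto simp: simplex_right_iff)
  have dpc: "{d, p, c} \<in> simplices L"
    using Cons.hyps d v p by (auto simp: simplex_right_iff)
  have c_path: "edge_path L (p # c # cs @ [q])"
    using edge_path_of_witnesses[OF edge_witnesses.Cons[OF Cons.hyps(1-4)]] Cons.prems by simp
  have d_path: "edge_path L (p # d # cs @ [q])"
    using edge_path_of_witnesses[OF edge_witnesses.Cons[OF d Cons.hyps(4)]] Cons.prems by simp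
  have "homotopic_paths L (p # c # cs @ [q]) (p # d # c # cs @ [q])"
    using homotopic_insert[of L "[]" p c "cs @ [q]" _ d] c_path dpc by simp
  also have "homotopic_paths L (p # d # c # cs @ [q]) (p # d # cs @ [q])"
    using homotopic_insert[of L "[p]" d r rs _ c] d_path dcr
    by (simp add: r homotopic_paths_sym)
  also have "homotopic_paths L (p # d # cs @ [q]) (p # d # es @ [q])"
  proof (rule homotopic_Cons[OF simplicial_complex_right])
    show "homotopic_paths L (d # cs @ [q]) (d # es @ [q])"
      using Cons.IH[OF es] Cons.prems d by simp
  qed (use p d v in \<open>auto simp: vertices_right simplex_right_iff\<close>)
  finally show ?case by (simp add: ds)
qed

text \<open>
  If \<open>v, w\<close> is expanded to \<open>v, u, w\<close> inside a simplex, a common witness \<open>e\<close> of this simplex serves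
  the old edge and both new ones. With this choice the two witness paths differ only in that \<open>e\<close> is
  repeated, and other choices are covered by \<open>homotopic_witnesses\<close>.
\<close>

lemma homotopic_witnesses_simple_equiv:
  assumes "simple_equiv K vs ws" "edge_witnesses B R vs cs" "edge_witnesses B R ws ds"
    and "p \<in> B" "q \<in> B" "R (hd vs) p" "R (last vs) q"
  shows "homotopic_paths L (p # cs @ [q]) (p # ds @ [q])"
proof -
  note ends = simple_equiv_edge_path[OF simplicial_complex_left assms(1)]
  from ends have A: "set vs \<subseteq> A" "set ws \<subseteq> A"
    by (auto simp: edge_path_def vertices_left)
  from assms(1) obtain xs v w ys \<sigma> u where path: "edge_path K (xs @ [v, w] @ ys)"
    and \<sigma>: "\<sigma> \<in> simplices K" "{u, v, w} \<subseteq> \<sigma>"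
    and eq: "vs = xs @ [v, w] @ ys" "ws = xs @ [v, u, w] @ ys"
    by (auto elim!: simple_equiv.cases)
  from \<sigma> obtain e where e: "e \<in> B" "R u e" "R v e" "R w e"
    by (auto simp: simplex_left_iff)
  have "successively (\<lambda>v w. {v, w} \<in> simplices K) (xs @ [v])"
    "successively (\<lambda>v w. {v, w} \<in> simplices K) (w # ys)"
    using path by (auto simp: edge_path_def successively_append_iff)
  then obtain as bs where as: "edge_witnesses B R (xs @ [v]) as"
    and bs: "edge_witnesses B R (w # ys) bs"
    using ex_edge_witnesses by (metis list.distinct(1) snoc_eq_iff_butlast)
  have vs: "edge_witnesses B R vs (as @ e # bs)"
    using edge_witnesses_append[OF as edge_witnesses.Cons[OF e(1,3,4) bs]] by (simp add: eq)
  have ws: "edge_witnesses B R ws (as @ e # e # bs)"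
    using edge_witnesses_append[OF as
        edge_witnesses.Cons[OF e(1,3,2) edge_witnesses.Cons[OF e(1,2,4) bs]]] by (simp add: eq)
  obtain r rs where r: "bs @ [q] = r # rs" by (cases "bs @ [q]") auto
  have "r \<in> B" using r edge_witnesses_subset[OF bs] assms(5) by (cases bs) auto
  moreover have "R w r"
    using edge_witnesses_related_hd[OF bs, of q] r assms(7) by (simp add: eq split: if_splits)
  moreover have "w \<in> A" using A by (simp add: eq)
  ultimately have er: "{e, r} \<in> simplices L"
    using e by (auto simp: simplex_right_iff)
  have "homotopic_paths L (p # cs @ [q]) (p # (as @ e # bs) @ [q])"
    using homotopic_witnesses[OF assms(2) vs A(1) assms(4-7)] .
  also have "homotopic_paths L (p # (as @ e # bs) @ [q]) (p # (as @ e # e # bs) @ [q])"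
    using homotopic_insert[of L "p # as" e r rs _ e] er
      edge_path_of_witnesses[OF vs A(1) assms(4-7)] by (simp add: r)
  also have "homotopic_paths L (p # (as @ e # e # bs) @ [q]) (p # ds @ [q])"
    using homotopic_witnesses[OF ws assms(3) A(2) assms(4,5)] assms(6,7) ends(3,4) by simp
  finally show ?thesis .
qed

lemma ex_edge_witnesses_loop:
  "vs \<in> edge_loops K b \<Longrightarrow> \<exists>cs. edge_witnesses B R vs cs"
  by (rule ex_edge_witnesses) (auto simp: edge_loops_def edge_path_def)

lemma witness_loop:
  assumes "vs \<in> edge_loops K b" "edge_witnesses B R vs cs" "p \<in> B" "R b p"
  shows "p # cs @ [p] \<in> edge_loops L p"
  using edge_path_of_witnesses[OF assms(2) _ assms(3,3)] assms
  by (auto simp: edge_loops_def edge_path_def vertices_left)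

lemma homotopic_witness_loops:
  assumes "homotopic_paths K vs ws" "vs \<in> edge_loops K b"
    and "edge_witnesses B R vs cs" "edge_witnesses B R ws ds" "p \<in> B" "R b p"
  shows "homotopic_paths L (p # cs @ [p]) (p # ds @ [p])"
  using assms(1,4) unfolding homotopic_paths_def[of K]
proof (induction arbitrary: ds rule: equivclp_induct)
  case base
  show ?case
    using homotopic_witnesses[OF assms(3) base _ assms(5,5)] assms(2,6)
    by (auto simp: edge_loops_def edge_path_def vertices_left)
next
  case (step y z)
  have y: "y \<in> edge_loops K b"
    using homotopic_edge_loops[OF simplicial_complex_left _ assms(2)] step(1)
    by (simp add: homotopic_paths_def)
  then obtain es where es: "edge_witnesses B R y es"
    using ex_edge_witnesses_loop by blast
  have "z \<in> edge_loops K b"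
    using homotopic_edge_loops[OF simplicial_complex_left _ y, of z] step(2)
    by (auto simp: homotopic_paths_def intro: r_into_equivclp equivclp_sym[OF r_into_equivclp])
  then have "homotopic_paths L (p # es @ [p]) (p # ds @ [p])"
    using step(2) homotopic_witnesses_simple_equiv[OF _ es step.prems assms(5,5)]
      homotopic_witnesses_simple_equiv[OF _ step.prems es assms(5,5)] y assms(6)
    by (auto simp: edge_loops_def dest: homotopic_paths_sym)
  with step.IH[OF es] show ?case by (rule homotopic_paths_trans)
qed

text \<open>
  The path \<open>b # vs @ [b]\<close> is the loop \<open>vs\<close> after a round trip through the dual complex.
\<close>

lemma homotopic_pad_loop:
  assumes "vs \<in> edge_loops K b"
  shows "homotopic_paths K (b # vs @ [b]) vs"
proof -
  have path: "edge_path K vs" and ends: "hd vs = b" "last vs = b" and "vs \<noteq> []"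
    using assms by (auto simp: edge_loops_def edge_path_def)
  from path obtain w ys where vs: "vs = b # w # ys"
    using ends by (cases vs; cases "tl vs") (auto simp: edge_path_def)
  from path obtain v zs where vs': "vs = zs @ [v, b]"
    using ends by (cases vs rule: rev_cases; cases "butlast vs" rule: rev_cases)
      (auto simp: edge_path_def)
  have "{b, w} \<in> simplices K" "{v, b} \<in> simplices K"
    using path unfolding edge_path_def
    by (simp add: vs) (use path in \<open>simp add: vs' edge_path_def successively_append_iff\<close>)
  then have 1: "homotopic_paths K vs (b # vs)"
    using homotopic_insert[of K "[]" b w ys "{b, w}" b] path by (simp add: vs)
  have "b # vs \<in> edge_loops K b"
    using homotopic_edge_loops[OF simplicial_complex_left 1 assms] .
  then have "homotopic_paths K (b # vs) (b # vs @ [b])"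
    using homotopic_insert[of K "b # zs" v b "[]" "{v, b}" b] \<open>{v, b} \<in> simplices K\<close>
    by (simp add: vs' edge_loops_def)
  with 1 show ?thesis by (meson homotopic_paths_sym homotopic_paths_trans)
qed

text \<open>
  The induced map enters only through its values on loop classes. That some function \<open>f\<close> has these
  values, whatever the representatives and witnesses, is the content of \<open>homotopic_witness_loops\<close>.
\<close>

theorem dowker_iso:
  assumes b: "b \<in> A" and p: "p \<in> B" "R b p"
    and f: "\<And>vs cs. vs \<in> edge_loops K b \<Longrightarrow> edge_witnesses B R vs cs \<Longrightarrow>
      f (loop_class K b vs) = loop_class L p (p # cs @ [p])"
  shows "f \<in> iso (pi1 K b) (pi1 L p)"
proof -
  interpret dual: dowker_relation B A "\<lambda>y x. R x y" by (rule dual)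
  have dual_witnesses: "edge_witnesses A (\<lambda>y x. R x y) (p # cs @ [p]) vs"
    if "vs \<in> edge_loops K b" "edge_witnesses B R vs cs" for vs cs
    using edge_witnesses_dual[OF that(2)] that(1) p
    by (auto simp: edge_loops_def edge_path_def vertices_left)
  have mult: "f (loop_class K b vs \<otimes>\<^bsub>pi1 K b\<^esub> loop_class K b ws) =
      f (loop_class K b vs) \<otimes>\<^bsub>pi1 L p\<^esub> f (loop_class K b ws)"
    if vs: "vs \<in> edge_loops K b" and ws: "ws \<in> edge_loops K b" for vs ws
  proof -
    obtain cs ds where cs: "edge_witnesses B R vs cs" and ds: "edge_witnesses B R ws ds"
      using ex_edge_witnesses_loop vs ws by blast
    have vw: "vs @ tl ws \<in> edge_loops K b" by (rule edge_loops_append[OF vs ws])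
    have "vs = butlast vs @ [b]" "ws = b # tl ws"
      using edge_loops_not_Nil[OF vs] edge_loops_not_Nil[OF ws] vs ws
        append_butlast_last_id[of vs] list.collapse[of ws] by (auto simp: edge_loops_def)
    then have cd: "edge_witnesses B R (vs @ tl ws) (cs @ ds)"
      using edge_witnesses_append[of B R "butlast vs" b cs "tl ws" ds] cs ds
      by (metis append.assoc append_Cons append_Nil)
    have cp: "p # cs @ [p] \<in> edge_loops L p" and dp: "p # ds @ [p] \<in> edge_loops L p"
      and cdp: "p # (cs @ ds) @ [p] \<in> edge_loops L p"
      using witness_loop vs ws vw cs ds cd p by blast+
    \<comment> \<open>The image of the product lacks only the \<open>p\<close> in the middle. Its neighbours \<open>r\<close> and \<open>s\<close> there
      are related to \<open>b\<close>, as is \<open>p\<close>, so that inserting \<open>p\<close> is a simple equivalence.\<close>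
    obtain r rs where r: "p # cs = rs @ [r]" by (cases "p # cs" rule: rev_cases) auto
    obtain s ss where s: "ds @ [p] = s # ss" by (cases "ds @ [p]") auto
    have "R b r" "R b s"
      using edge_witnesses_related_last[OF cs, of p] edge_witnesses_related_hd[OF ds, of p]
        vs ws p r s by (auto simp: edge_loops_def)
    moreover have "r \<in> B"
      using r p edge_witnesses_subset[OF cs] by (metis insert_iff list.simps(15) in_set_conv_decomp subsetD)
    moreover have "s \<in> B"
      using s p edge_witnesses_subset[OF ds] by (cases ds) auto
    ultimately have "{p, r, s} \<in> simplices L"
      using b p by (auto simp: simplex_right_iff)
    moreover have split: "p # (cs @ ds) @ [p] = rs @ r # s # ss"
      "(p # cs @ [p]) @ tl (p # ds @ [p]) = rs @ r # p # s # ss"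
      using r s by (metis append.assoc append_Cons append_Nil list.sel(3))+
    moreover have "edge_path L (rs @ r # s # ss)"
      using cdp by (simp only: edge_loops_def split(1) mem_Collect_eq)
    ultimately have "homotopic_paths L (p # (cs @ ds) @ [p]) ((p # cs @ [p]) @ tl (p # ds @ [p]))"
      using homotopic_insert[of L rs r s ss "{p, r, s}" p] by (simp only: split)
    then show ?thesis
      using loop_class_eq_iff[OF cdp edge_loops_append[OF cp dp]] mult_pi1[OF simplicial_complex_left vs ws]
        mult_pi1[OF simplicial_complex_right cp dp] f[OF vw cd] f[OF vs cs] f[OF ws ds] by simp
  qed
  have inj: "loop_class K b vs = loop_class K b ws"
    if vs: "vs \<in> edge_loops K b" and ws: "ws \<in> edge_loops K b"
      and eq: "f (loop_class K b vs) = f (loop_class K b ws)" for vs ws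
  proof -
    obtain cs ds where cs: "edge_witnesses B R vs cs" and ds: "edge_witnesses B R ws ds"
      using ex_edge_witnesses_loop vs ws by blast
    have cp: "p # cs @ [p] \<in> edge_loops L p" and dp: "p # ds @ [p] \<in> edge_loops L p"
      using witness_loop vs ws cs ds p by blast+
    have "homotopic_paths L (p # cs @ [p]) (p # ds @ [p])"
      using eq f[OF vs cs] f[OF ws ds] loop_class_eq_iff[OF cp dp] by simp
    then have "homotopic_paths K (b # vs @ [b]) (b # ws @ [b])"
      using dual.homotopic_witness_loops[OF _ cp dual_witnesses[OF vs cs]
          dual_witnesses[OF ws ds] b] p by simp
    then have "homotopic_paths K vs ws"
      using homotopic_pad_loop[OF vs] homotopic_pad_loop[OF ws]
      by (meson homotopic_paths_sym homotopic_paths_trans)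
    then show ?thesis using loop_class_eq_iff[OF vs ws] by simp
  qed
  have surj: "\<exists>vs\<in>edge_loops K b. f (loop_class K b vs) = loop_class L p cs"
    if cs: "cs \<in> edge_loops L p" for cs
  proof -
    obtain vs where vs: "edge_witnesses A (\<lambda>y x. R x y) cs vs"
      using dual.ex_edge_witnesses_loop cs by blast
    have loop: "b # vs @ [b] \<in> edge_loops K b"
      using dual.witness_loop[OF cs vs b] p by simp
    have wit: "edge_witnesses B R (b # vs @ [b]) cs"
      using edge_witnesses_dual[OF vs, of B b b] cs p
      by (auto simp: edge_loops_def edge_path_def vertices_right)
    have "loop_class L p (p # cs @ [p]) = loop_class L p cs"
      using dual.homotopic_pad_loop[OF cs] loop_class_eq_iff[OF witness_loop[OF loop wit p] cs] by simp
    then show ?thesis using f[OF loop wit] loop by auto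
  qed
  have closed: "f (loop_class K b vs) \<in> carrier (pi1 L p)" if vs: "vs \<in> edge_loops K b" for vs
    using ex_edge_witnesses_loop[OF vs] f[OF vs] witness_loop[OF vs _ p] by (auto simp: carrier_pi1)
  have "f \<in> hom (pi1 K b) (pi1 L p)"
    by (rule homI) (use mult closed in \<open>auto simp: carrier_pi1[of K]\<close>)
  moreover have "inj_on f (carrier (pi1 K b))"
    using inj by (auto simp: inj_on_def carrier_pi1)
  moreover have "f ` carrier (pi1 K b) = carrier (pi1 L p)"
    using closed surj by (fastforce simp: carrier_pi1)
  ultimately show ?thesis by (simp add: iso_def bij_betw_def)
qed

end

section \<open>Common divisors and prime divisors\<close>

lemma dowker_relation_divisibility:
  assumes "finite X" "0 \<notin> X"
  shows "dowker_relation (X - {1}) (prime_divisors_of X) (\<lambda>v q. q dvd v)"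
proof
  show "finite (prime_divisors_of X)"
    using simplicial_complex_prime_divisor[OF assms]
    by (simp add: simplicial_complex_def prime_divisor_complex_def)
  show "\<exists>q\<in>prime_divisors_of X. q dvd v" if "v \<in> X - {1}" for v
    using that prime_factor_nat[of v] by (auto simp: prime_divisors_of_def)
qed (use assms in \<open>auto simp: prime_divisors_of_def\<close>)

lemma common_divisor_complex_eq:
  assumes "0 \<notin> X"
  shows "common_divisor_complex X = dowker_complex (X - {1}) (prime_divisors_of X) (\<lambda>v q. q dvd v)"
proof -
  have "Gcd V > 1 \<longleftrightarrow> (\<exists>q\<in>prime_divisors_of X. \<forall>v\<in>V. q dvd v)"
    if V: "V \<noteq> {}" "V \<subseteq> X - {1}" for V
  proof
    assume "Gcd V > 1"
    then obtain q where q: "prime q" "q dvd Gcd V" using prime_factor_nat[of "Gcd V"] by auto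
    then have "\<forall>v\<in>V. q dvd v" by (meson Gcd_dvd dvd_trans)
    then show "\<exists>q\<in>prime_divisors_of X. \<forall>v\<in>V. q dvd v"
      using V q(1) by (auto simp: prime_divisors_of_def)
  next
    assume "\<exists>q\<in>prime_divisors_of X. \<forall>v\<in>V. q dvd v"
    then obtain q where "prime q" "q dvd Gcd V"
      by (auto simp: prime_divisors_of_def intro: Gcd_greatest)
    moreover have "Gcd V \<noteq> 0" using V assms by (auto simp: Gcd_0_iff)
    ultimately show "Gcd V > 1" by (metis One_nat_def Suc_lessI gr0I nat_dvd_1_iff_1 not_prime_1)
  qed
  then show ?thesis by (auto simp: common_divisor_complex_def dowker_complex_def)
qed

text \<open>
  In the prime divisor complex the common multiple ranges over all of \<open>X\<close>; the value 1 is harmless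
  because no prime divides it.
\<close>

lemma prime_divisor_complex_eq:
  "prime_divisor_complex X =
    dowker_complex (prime_divisors_of X) (X - {1}) (\<lambda>q v. q dvd v)"
proof -
  have "(\<exists>v\<in>X. \<forall>q\<in>Q. q dvd v) \<longleftrightarrow> (\<exists>v\<in>X - {1}. \<forall>q\<in>Q. q dvd v)"
    if Q: "Q \<noteq> {}" "Q \<subseteq> prime_divisors_of X" for Q
  proof -
    from Q obtain q where "q \<in> Q" "prime q" by (auto simp: prime_divisors_of_def)
    then have "v \<noteq> 1" if "\<forall>q\<in>Q. q dvd v" for v using that not_prime_unit[of q] by auto
    then show ?thesis by blast
  qed
  then show ?thesis unfolding prime_divisor_complex_def dowker_complex_def by blast
qed

lemma eta_choices_iff:
  assumes "vs \<noteq> []" "set vs \<subseteq> X - {1}"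
  shows "\<omega>s \<in> eta_choices vs \<longleftrightarrow> edge_witnesses (prime_divisors_of X) (\<lambda>v q. q dvd v) vs \<omega>s"
  using assms
proof (induction vs arbitrary: \<omega>s rule: induct_list012)
  case 1
  then show ?case by simp
next
  case (2 v)
  then show ?case by (auto simp: eta_choices_def edge_witnesses_singleton_iff)
next
  case (3 v w vs)
  have "\<omega>s \<in> eta_choices (v # w # vs) \<longleftrightarrow>
      (\<exists>q qs. \<omega>s = q # qs \<and> q \<in> eta {v, w} \<and> qs \<in> eta_choices (w # vs))"
    by (cases \<omega>s) (auto simp: eta_choices_def less_Suc_eq_0_disj)
  moreover have "q \<in> eta {v, w} \<longleftrightarrow> q \<in> prime_divisors_of X \<and> q dvd v \<and> q dvd w" for q
    using 3 by (auto simp: eta_def prime_divisors_of_def)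
  ultimately show ?case using 3 by (simp add: edge_witnesses_Cons_iff)
qed

text \<open>
  The union defining \<^const>\<open>eta_star\<close> runs over all representatives and all choices of primes. It is
  a union of equal classes because the class of the witness loop does not depend on either.
\<close>

lemma eta_star_loop_class:
  assumes X: "finite X" "0 \<notin> X" and p: "prime p" "p dvd b"
    and vs: "vs \<in> edge_loops (common_divisor_complex X) b"
    and \<omega>s: "edge_witnesses (prime_divisors_of X) (\<lambda>v q. q dvd v) vs \<omega>s"
  shows "eta_star X p (loop_class (common_divisor_complex X) b vs) =
    loop_class (prime_divisor_complex X) p (p # \<omega>s @ [p])"
proof -
  interpret dowker_relation "X - {1}" "prime_divisors_of X" "\<lambda>v q. q dvd v"
    by (rule dowker_relation_divisibility[OF X])
  note eqs = common_divisor_complex_eq[OF X(2)] prime_divisor_complex_eq[of X]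
  have "b \<in> X - {1}"
    using vs unfolding eqs edge_loops_def edge_path_def vertices_left
    by (metis (mono_tags, lifting) hd_in_set list.size(3) mem_Collect_eq not_numeral_le_zero subsetD)
  then have pB: "p \<in> prime_divisors_of X" using p by (auto simp: prime_divisors_of_def)
  have *: "loop_class L p (p # \<omega>s' @ [p]) = loop_class L p (p # \<omega>s @ [p])"
    if ws: "ws \<in> loop_class K b vs" and choice: "\<omega>s' \<in> eta_choices ws" for ws \<omega>s'
  proof -
    have ws: "ws \<in> edge_loops K b" "homotopic_paths K vs ws"
      using ws by (auto simp: loop_class_def loop_homotopy_def)
    then have wit: "edge_witnesses (prime_divisors_of X) (\<lambda>v q. q dvd v) ws \<omega>s'"
      using choice eta_choices_iff[of ws X \<omega>s'] edge_loops_not_Nil[OF ws(1)]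
      by (auto simp: edge_loops_def edge_path_def vertices_left simp del: One_nat_def)
    note vs' = vs[unfolded eqs]
    have "homotopic_paths L (p # \<omega>s @ [p]) (p # \<omega>s' @ [p])"
      by (rule homotopic_witness_loops[OF ws(2) vs' \<omega>s wit pB p(2)])
    then show ?thesis
      using loop_class_eq_iff[OF witness_loop[OF vs' \<omega>s pB p(2)] witness_loop[OF ws(1) wit pB p(2)]]
      by simp
  qed
  have "vs \<in> loop_class K b vs"
    using vs unfolding eqs by (auto simp: loop_class_def loop_homotopy_def homotopic_paths_def)
  moreover have "\<omega>s \<in> eta_choices vs"
    using \<omega>s eta_choices_iff[of vs X \<omega>s] vs edge_loops_not_Nil[OF vs] unfolding eqs
    by (auto simp: edge_loops_def edge_path_def vertices_left simp del: One_nat_def)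
  ultimately show ?thesis using * unfolding eta_star_def eqs by blast
qed

theorem theorem1p1:
  fixes G :: "('a, 'm) monoid_scheme" and b p :: nat
  assumes "group G" and "finite (carrier G)"
    and "connected_complex (common_divisor_complex (char_degrees G))"
    and "b \<in> vertices (common_divisor_complex (char_degrees G))"
    and "prime p" and "p dvd b"
  shows "eta_star (char_degrees G) p
    \<in> iso (pi1 (common_divisor_complex (char_degrees G)) b)
          (pi1 (prime_divisor_complex (char_degrees G)) p)"
proof -
  let ?X = "char_degrees G"
  have X: "finite ?X" "0 \<notin> ?X"
    using assms finite_char_degrees zero_notin_char_degrees by blast+
  interpret dowker_relation "?X - {1}" "prime_divisors_of ?X" "\<lambda>v q. q dvd v"
    by (rule dowker_relation_divisibility[OF X])
  have b: "b \<in> ?X - {1}" using assms(4) by (simp add: common_divisor_complex_def)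
  then have p: "p \<in> prime_divisors_of ?X" using assms(5,6) by (auto simp: prime_divisors_of_def)
  show ?thesis
    using dowker_iso[OF b p assms(6)] eta_star_loop_class[OF X assms(5,6)]
    unfolding common_divisor_complex_eq[OF X(2)] prime_divisor_complex_eq by blast
qed

end
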